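(* Fix $c>c'>1$ and $\gamma>0$, and let $G\sim\mathcal{G}(n,p)$ with $p=\frac{c}{n}$ and $G'\sim\mathcal{G}(n,p')$ with $p'=\frac{c'}{n}$. If $\omega_n$ and $L'_n$ are (deterministic) sequences such that $\omega_n\to\infty$ as $n\to\infty$ and, with high probability, $L_{\max}(G')\geq L'_n\geq\gamma n$, then with high probability $$\{k\in\mathbb{Z}:\ \omega_n\leq k\leq L'_n-\omega_n\}\subset\mathscr{L}(G).$$ The same conclusion holds when $G\sim\mathcal{D}(n,p)$ with $p=\frac{c}{n}$ and $G'\sim\mathcal{D}(n,p')$ with $p'=\frac{c'}{n}$, for $c,c',\gamma$ and sequences $\omega_n,L'_n$ satisfying the same assumptions (with respect to this $G'$).
   Context: $\mathcal{G}(n,p)$ is the binomial random graph on $n$ vertices, in which each undirected edge appears independently with probability $p$. $\mathcal{D}(n,p)$ is its directed analog: each of the $n(n-1)$ ordered pairs of distinct vertices is a directed edge independently with probability $p$. For a graph (resp. digraph) $G$, $\mathscr{L}(G)$ is the set of lengths of all cycles (resp. directed cycles) in $G$, and $L_{\max}(G)$ is the length of a longest cycle (resp. directed cycle) in $G$. An event $E_n$ holds with high probability if $\mathbb{P}(E_n)\to1$ as $n\to\infty$. *)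

theory Defs
  imports "HOL-Probability.Probability" "Graph_Theory.Graph_Theory"
begin

text \<open>As in the Graph_Theory entry, an undirected graph is the symmetric digraph that contains
  both orientations of every edge.  The random choices for G(n,p) are indexed by the unordered
  pairs, so both orientations of an edge are present or absent together.

  \<open>bernoulli_pmf\<close> clamps its parameter to the unit interval; for \<open>p = c / n\<close> this
  matters only for the finitely many \<open>n < c\<close>.\<close>

definition unordered_pairs :: "nat \<Rightarrow> nat set set" where
  "unordered_pairs n = {e. e \<subseteq> {..<n} \<and> card e = 2}"

definition ordered_pairs :: "nat \<Rightarrow> (nat \<times> nat) set" where
  "ordered_pairs n = {(u, v). u < n \<and> v < n \<and> u \<noteq> v}"

definition binomial_graph :: "nat \<Rightarrow> real \<Rightarrow> nat pair_pre_digraph pmf" where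
  "binomial_graph n p =
     map_pmf (\<lambda>X. \<lparr>pverts = {..<n}, parcs = {(u, v). {u, v} \<in> unordered_pairs n \<and> X {u, v}}\<rparr>)
       (Pi_pmf (unordered_pairs n) False (\<lambda>_. bernoulli_pmf p))"

definition binomial_digraph :: "nat \<Rightarrow> real \<Rightarrow> nat pair_pre_digraph pmf" where
  "binomial_digraph n p =
     map_pmf (\<lambda>X. \<lparr>pverts = {..<n}, parcs = {e \<in> ordered_pairs n. X e}\<rparr>)
       (Pi_pmf (ordered_pairs n) False (\<lambda>_. bernoulli_pmf p))"

definition dicycle_lengths :: "'a pair_pre_digraph \<Rightarrow> nat set" where
  "dicycle_lengths G = {length p |p. pre_digraph.cycle (with_proj G) p}"

text \<open>In a symmetric digraph every edge gives a directed cycle \<open>u, v, u\<close>, which is not a cycle of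
  the undirected graph.  The directed cycles with at least three arcs are exactly the undirected
  cycles, each with a starting point and an orientation.\<close>

definition cycle_lengths :: "'a pair_pre_digraph \<Rightarrow> nat set" where
  "cycle_lengths G = {length p |p. pre_digraph.cycle (with_proj G) p \<and> 3 \<le> length p}"

text \<open>Applied to the set of cycle lengths of a finite (di)graph; the value for an acyclic one is 0
  by convention.\<close>

definition longest :: "nat set \<Rightarrow> nat" where
  "longest L = Max (insert 0 L)"

definition whp :: "(nat \<Rightarrow> 'a pmf) \<Rightarrow> (nat \<Rightarrow> 'a \<Rightarrow> bool) \<Rightarrow> bool" where
  "whp M E \<longleftrightarrow> (\<lambda>n. measure_pmf.prob (M n) {x. E n x}) \<longlonglongrightarrow> 1"

end

theory Submission
  imports Defs
begin

text \<open>
  The proof is by sprinkling.  Since \<open>c > c'\<close>, a graph with edge probability \<open>c / n\<close> is the union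
  of one with edge probability \<open>c' / n\<close> and of independent extra edges, each present with probability
  at least \<open>(c - c') / n\<close> (\<open>Pi_pmf_bernoulli_sprinkle\<close>).  Fix the first graph and a longest cycle
  \<open>x 0, \<dots>, x (L - 1)\<close> in it; by hypothesis \<open>L \<ge> \<gamma> n\<close> outside an event of vanishing
  probability.  From here on only the extra edges are random, and the only ones that matter are the
  chords of this cycle.

  A pair of chords closes two arcs of the long cycle up to a cycle of a prescribed length \<open>k\<close>.
  There are two shapes.  For \<open>k\<close> up to about \<open>L / 3\<close> the new cycle runs through two segments
  \<open>[z..u]\<close> and \<open>[v..w]\<close>, with the nested chords \<open>x u \<rightarrow> x v\<close> and \<open>x w \<rightarrow> x z\<close>.
  For larger \<open>k\<close> it omits two gaps of the long cycle, jumping over them by the disjoint chords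
  \<open>x u \<rightarrow> x v\<close> and \<open>x w \<rightarrow> x z\<close> with \<open>u < v \<le> w < z\<close>.  In both shapes the span of the first chord
  and \<open>k\<close> determine the span of the second, so the admissible pairs of chords fall into blocks, one
  for each span \<open>d\<close> of the first chord, and distinct blocks involve disjoint sets of chords.  Hence
  the blocks succeed or fail independently.

  For a short length there are of order \<open>n\<close> blocks.  A block contains the first chord with probability
  bounded below, and given that chord about \<open>k / 2\<close> second chords would do, so that it succeeds with
  probability of order at least \<open>k / n\<close>; the probability that all blocks fail is therefore
  exponentially small in \<open>k\<close>.  For a
  long length there are of order \<open>L - k\<close> blocks and each succeeds with probability bounded below, so
  that the failure probability is exponentially small in \<open>L - k\<close>.  Summing two geometric series over
  \<open>a \<le> k \<le> L - a\<close> bounds the probability that some length is missing by a constant times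
  \<open>s ^ a\<close> with \<open>s < 1\<close> (\<open>prob_missing_cycle_length_le\<close>), and this tends to 0 when \<open>a = \<lceil>\<omega> n\<rceil>\<close>.

  The argument treats graphs and digraphs at once: a Boolean variable is attached to each pair of
  distinct vertices through a labelling that identifies at most the two orientations of a pair
  (locale \<open>pair_labelling\<close>).  This loses nothing, because chords from different blocks, and a first
  and a second chord, always differ as unordered pairs.
\<close>

section \<open>Independent blocks of Bernoulli variables\<close>

definition depends_on :: "(('i \<Rightarrow> bool) \<Rightarrow> bool) \<Rightarrow> 'i set \<Rightarrow> bool" where
  "depends_on P A \<longleftrightarrow> (\<forall>X Y. (\<forall>e\<in>A. X e = Y e) \<longrightarrow> P X = P Y)"

text \<open>
  Splitting the product measure into the coordinates in \<open>A\<close> and the others makes the two events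
  depend on different factors.
\<close>
lemma prob_conj_disjoint_coordinates:
  assumes "finite S" "A \<subseteq> S" "A \<inter> B = {}" "depends_on P A" "depends_on Q B"
  shows "measure_pmf.prob (Pi_pmf S dflt p) {X. P X \<and> Q X} =
         measure_pmf.prob (Pi_pmf S dflt p) {X. P X} * measure_pmf.prob (Pi_pmf S dflt p) {X. Q X}"
proof -
  define M N where "M = Pi_pmf A dflt p" and "N = Pi_pmf (S - A) dflt p"
  define h where "h = (\<lambda>(f, g) x. if x \<in> A then f x else g x :: bool)"
  have "S = A \<union> (S - A)" using assms by auto
  moreover have "Pi_pmf (A \<union> (S - A)) dflt p = map_pmf h (pair_pmf M N)"
    unfolding M_def N_def h_def using assms(1,2)
    by (intro Pi_pmf_union) (auto intro: finite_subset)
  ultimately have S: "Pi_pmf S dflt p = map_pmf h (pair_pmf M N)" by simp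
  have P: "P (h (f, g)) = P f" for f g
    by (rule assms(4)[unfolded depends_on_def, rule_format]) (simp add: h_def)
  have Q: "Q (h (f, g)) = Q g" for f g
    by (rule assms(5)[unfolded depends_on_def, rule_format]) (use assms(3) in \<open>auto simp: h_def\<close>)
  have "measure_pmf.prob (Pi_pmf S dflt p) {X. P' X \<and> Q' X} =
        measure_pmf.prob M {X. P' X} * measure_pmf.prob N {X. Q' X}"
    if "\<And>f g. P' (h (f, g)) = P' f" "\<And>f g. Q' (h (f, g)) = Q' g" for P' Q'
  proof -
    have "h -` {X. P' X \<and> Q' X} = {X. P' X} \<times> {X. Q' X}" using that by auto
    moreover have "measure_pmf.prob (pair_pmf M N) ({X. P' X} \<times> {X. Q' X}) =
        measure_pmf.prob (pair_pmf M N) (({X. P' X} \<inter> set_pmf M) \<times> ({X. Q' X} \<inter> set_pmf N))"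
      by (subst measure_Int_set_pmf[symmetric]) (simp add: Times_Int_Times)
    moreover have "\<dots> = measure_pmf.prob M {X. P' X} * measure_pmf.prob N {X. Q' X}"
      by (subst measure_pmf_prob_product) (auto simp: measure_Int_set_pmf)
    ultimately show ?thesis unfolding S measure_map_pmf by simp
  qed
  from this[OF P Q] this[OF P, of "\<lambda>_. True"] this[of "\<lambda>_. True", OF _ Q]
  show ?thesis by simp
qed

lemma prob_all_blocks_le:
  fixes D :: "'d set"
  assumes "finite S" "finite D"
    and "\<And>d. d \<in> D \<Longrightarrow> U d \<subseteq> S"
    and "\<And>d d'. d \<in> D \<Longrightarrow> d' \<in> D \<Longrightarrow> d \<noteq> d' \<Longrightarrow> U d \<inter> U d' = {}"
    and "\<And>d. d \<in> D \<Longrightarrow> depends_on (F d) (U d)"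
    and "\<And>d. d \<in> D \<Longrightarrow> measure_pmf.prob (Pi_pmf S dflt p) {X. F d X} \<le> t"
  shows "measure_pmf.prob (Pi_pmf S dflt p) {X. \<forall>d\<in>D. F d X} \<le> t ^ card D"
  using assms(2-)
proof (induction D rule: finite_induct)
  case empty
  then show ?case by simp
next
  case (insert d D)
  have dep: "depends_on (\<lambda>X. \<forall>d\<in>D. F d X) (\<Union> (U ` D))"
    using insert.prems(3) unfolding depends_on_def by (auto; blast)
  have "U d \<inter> \<Union> (U ` D) = {}"
    using insert.prems(2)[of d] insert.hyps by auto
  then have "measure_pmf.prob (Pi_pmf S dflt p) {X. F d X \<and> (\<forall>d\<in>D. F d X)} =
    measure_pmf.prob (Pi_pmf S dflt p) {X. F d X} * measure_pmf.prob (Pi_pmf S dflt p) {X. \<forall>d\<in>D. F d X}"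
    using prob_conj_disjoint_coordinates[OF assms(1) _ _ _ dep, of "U d" "F d" dflt p]
      insert.prems(1)[of d] insert.prems(3)[of d] by simp
  also have "\<dots> \<le> t * t ^ card D"
    using insert order_trans[OF measure_nonneg insert.prems(4)[of d]] by (intro mult_mono) auto
  finally show ?case using insert.hyps by simp
qed

lemma prob_no_success:
  assumes "finite S" "T \<subseteq> S" "0 \<le> q" "q \<le> 1"
  shows "measure_pmf.prob (Pi_pmf S False (\<lambda>_. bernoulli_pmf q)) {X. \<forall>e\<in>T. \<not> X e} = (1 - q) ^ card T"
proof -
  have "{X. \<forall>e\<in>T. \<not> X e} = Pi S (\<lambda>e. if e \<in> T then {False} else UNIV)"
    using assms(2) by (auto simp: Pi_def)
  moreover have "measure_pmf.prob (bernoulli_pmf q) {False} = 1 - q"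
    using assms by (simp add: measure_pmf_single)
  then have "(\<Prod>e\<in>S. measure_pmf.prob (bernoulli_pmf q) (if e \<in> T then {False} else UNIV)) =
        (\<Prod>e\<in>S. if e \<in> T then 1 - q else 1)"
    by (intro prod.cong) auto
  moreover have "\<dots> = (1 - q) ^ card T"
    using assms(1,2) by (simp add: prod.If_cases Int_absorb1)
  ultimately show ?thesis using assms(1) by (simp add: measure_Pi_pmf_Pi)
qed

text \<open>
  Scan the candidates \<open>a i\<close> for a success.  The scan finds one with probability \<open>1 - (1 - q) ^ M\<close>, and
  independently of it one of its \<open>m\<close> partners succeeds with probability \<open>1 - (1 - q) ^ m\<close>.
  The induction removes the candidates one at a time, so that no conditioning on the outcome of the
  scan is necessary; the partners of different candidates may coincide.
\<close>
lemma prob_no_matching_pair_le: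
  fixes a :: "nat \<Rightarrow> 'i" and b :: "nat \<Rightarrow> nat \<Rightarrow> 'i"
  assumes S: "finite S" and q: "0 \<le> q" "q \<le> 1"
    and "\<And>i. i < M \<Longrightarrow> a i \<in> S" "\<And>i j. i < M \<Longrightarrow> j < m \<Longrightarrow> b i j \<in> S"
    and "inj_on a {..<M}" "\<And>i. i < M \<Longrightarrow> inj_on (b i) {..<m}"
    and "\<And>i i' j. i < M \<Longrightarrow> i' < M \<Longrightarrow> j < m \<Longrightarrow> a i \<noteq> b i' j"
  shows "measure_pmf.prob (Pi_pmf S False (\<lambda>_. bernoulli_pmf q))
           {X. \<forall>i<M. X (a i) \<longrightarrow> (\<forall>j<m. \<not> X (b i j))}
         \<le> 1 - (1 - (1 - q) ^ M) * (1 - (1 - q) ^ m)"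
  using assms(4-)
proof (induction M)
  case 0
  then show ?case by simp
next
  case (Suc M)
  let ?P = "\<lambda>F. measure_pmf.prob (Pi_pmf S False (\<lambda>_. bernoulli_pmf q)) {X. F X}"
  define F where "F = (\<lambda>X. \<forall>i<M. X (a i) \<longrightarrow> (\<forall>j<m. \<not> X (b i j)))"
  define N where "N = (\<lambda>X. \<forall>e\<in>b M ` {..<m}. \<not> X e)"
  have IH: "?P F \<le> 1 - (1 - (1 - q) ^ M) * (1 - (1 - q) ^ m)"
    unfolding F_def
  proof (rule Suc.IH)
    show "inj_on a {..<M}" using Suc.prems(3) by (rule inj_on_subset) auto
  qed (use Suc.prems in auto)
  have aM: "a M \<in> S" using Suc.prems(1) by simp
  have pa: "?P (\<lambda>X. \<not> X (a M)) = 1 - q"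
    using prob_no_success[OF S, of "{a M}" q] aM q by simp
  have "?P (\<lambda>X. X (a M)) = 1 - ?P (\<lambda>X. \<not> X (a M))"
    by (subst measure_pmf.prob_compl[symmetric]) (auto intro!: arg_cong[where f="measure_pmf.prob _"])
  with pa have pa': "?P (\<lambda>X. X (a M)) = q" by simp
  have "card (b M ` {..<m}) = m" using Suc.prems(4)[of M] by (simp add: card_image)
  then have pN: "?P N = (1 - q) ^ m"
    unfolding N_def using prob_no_success[OF S, of "b M ` {..<m}" q] Suc.prems(2) q by auto
  have d1: "depends_on (\<lambda>X. \<not> X (a M)) {a M}" "depends_on (\<lambda>X. X (a M)) {a M}"
    by (auto simp: depends_on_def)
  have dF: "depends_on F (a ` {..<M} \<union> (\<Union>i<M. b i ` {..<m}))"
    unfolding depends_on_def F_def by (auto; blast)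
   have "a M \<notin> a ` {..<M}"
  proof
    assume "a M \<in> a ` {..<M}"
    then obtain i where "i < M" "a M = a i" by auto
    with inj_onD[OF Suc.prems(3), of M i] show False by auto
  qed
  then have "{a M} \<inter> (a ` {..<M} \<union> (\<Union>i<M. b i ` {..<m})) = {}"
    using Suc.prems(5)[OF lessI less_SucI] by auto
  then have i1: "?P (\<lambda>X. \<not> X (a M) \<and> F X) = (1 - q) * ?P F"
    using prob_conj_disjoint_coordinates[OF S _ _ d1(1) dF] aM pa by simp
  have "depends_on N (b M ` {..<m})" unfolding depends_on_def N_def by auto
  then have i2: "?P (\<lambda>X. X (a M) \<and> N X) = q * (1 - q) ^ m"
    using Suc.prems(5)[of M M] aM pa' pN
    by (subst prob_conj_disjoint_coordinates[OF S _ _ d1(2)]) auto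
  have "?P (\<lambda>X. \<forall>i<Suc M. X (a i) \<longrightarrow> (\<forall>j<m. \<not> X (b i j)))
        \<le> measure_pmf.prob (Pi_pmf S False (\<lambda>_. bernoulli_pmf q))
             ({X. \<not> X (a M) \<and> F X} \<union> {X. X (a M) \<and> N X})"
    by (intro measure_pmf.finite_measure_mono) (auto simp: F_def N_def)
  also have "\<dots> \<le> ?P (\<lambda>X. \<not> X (a M) \<and> F X) + ?P (\<lambda>X. X (a M) \<and> N X)"
    by (rule measure_Un_le) auto
  \<comment> \<open>Either \<open>a M\<close> fails and the other candidates are as before, or it succeeds and its partners fail.\<close>
  also have "\<dots> \<le> (1 - q) * (1 - (1 - (1 - q) ^ M) * (1 - (1 - q) ^ m)) + q * (1 - q) ^ m"
    unfolding i1 i2 using IH q by (intro add_right_mono mult_left_mono) auto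
  also have "\<dots> = 1 - (1 - (1 - q) ^ Suc M) * (1 - (1 - q) ^ m)"
    by (simp add: algebra_simps)
  finally show ?case .
qed

text \<open>
  Distinct blocks share no variable, hence they fail independently; within a block one variable may
  be a partner of several candidates.
\<close>
lemma prob_no_matching_pair_in_blocks_le:
  fixes a :: "nat \<Rightarrow> nat \<Rightarrow> 'i" and b :: "nat \<Rightarrow> nat \<Rightarrow> nat \<Rightarrow> 'i" and D :: "nat set"
  assumes S: "finite S" and q: "0 \<le> q" "q \<le> 1" and "finite D"
    and aS: "\<And>d i. d \<in> D \<Longrightarrow> i < M \<Longrightarrow> a d i \<in> S"
    and bS: "\<And>d i j. d \<in> D \<Longrightarrow> i < M \<Longrightarrow> j < m \<Longrightarrow> b d i j \<in> S"
    and a: "\<And>d d' i i'. d \<in> D \<Longrightarrow> d' \<in> D \<Longrightarrow> i < M \<Longrightarrow> i' < M \<Longrightarrow> a d i = a d' i' \<Longrightarrow> d = d' \<and> i = i'"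
    and b: "\<And>d d' i i' j j'. d \<in> D \<Longrightarrow> d' \<in> D \<Longrightarrow> i < M \<Longrightarrow> i' < M \<Longrightarrow> j < m \<Longrightarrow> j' < m \<Longrightarrow>
              b d i j = b d' i' j' \<Longrightarrow> d = d' \<and> (i = i' \<longrightarrow> j = j')"
    and ab: "\<And>d d' i i' j. d \<in> D \<Longrightarrow> d' \<in> D \<Longrightarrow> i < M \<Longrightarrow> i' < M \<Longrightarrow> j < m \<Longrightarrow> a d i \<noteq> b d' i' j"
  shows "measure_pmf.prob (Pi_pmf S False (\<lambda>_. bernoulli_pmf q))
           {X. \<forall>d\<in>D. \<forall>i<M. X (a d i) \<longrightarrow> (\<forall>j<m. \<not> X (b d i j))}
         \<le> (1 - (1 - (1 - q) ^ M) * (1 - (1 - q) ^ m)) ^ card D"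
proof (rule prob_all_blocks_le[where U = "\<lambda>d. a d ` {..<M} \<union> (\<Union>i<M. b d i ` {..<m})"])
  show "(a d ` {..<M} \<union> (\<Union>i<M. b d i ` {..<m})) \<inter> (a d' ` {..<M} \<union> (\<Union>i<M. b d' i ` {..<m})) = {}"
    if "d \<in> D" "d' \<in> D" "d \<noteq> d'" for d d'
  proof -
    have "a d i \<noteq> a d' i'" if "i < M" "i' < M" for i i'
      using a[OF \<open>d \<in> D\<close> \<open>d' \<in> D\<close> that] \<open>d \<noteq> d'\<close> by metis
    moreover have "b d i j \<noteq> b d' i' j'" if "i < M" "i' < M" "j < m" "j' < m" for i i' j j'
      using b[OF \<open>d \<in> D\<close> \<open>d' \<in> D\<close> that] \<open>d \<noteq> d'\<close> by metis
    moreover have "a d i \<noteq> b d' i' j" "a d' i \<noteq> b d i' j" if "i < M" "i' < M" "j < m" for i i' j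
      using ab[OF \<open>d \<in> D\<close> \<open>d' \<in> D\<close> that] ab[OF \<open>d' \<in> D\<close> \<open>d \<in> D\<close> that] by auto
    ultimately have False
      if "e \<in> a d ` {..<M} \<union> (\<Union>i<M. b d i ` {..<m})" "e \<in> a d' ` {..<M} \<union> (\<Union>i<M. b d' i ` {..<m})" for e
      using that by (elim UnE imageE UN_E) (simp_all, metis+)
    then show ?thesis by blast
  qed
  show "depends_on (\<lambda>X. \<forall>i<M. X (a d i) \<longrightarrow> (\<forall>j<m. \<not> X (b d i j)))
          (a d ` {..<M} \<union> (\<Union>i<M. b d i ` {..<m}))" for d
    unfolding depends_on_def by (auto; blast)
  show "measure_pmf.prob (Pi_pmf S False (\<lambda>_. bernoulli_pmf q))
          {X. \<forall>i<M. X (a d i) \<longrightarrow> (\<forall>j<m. \<not> X (b d i j))}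
        \<le> 1 - (1 - (1 - q) ^ M) * (1 - (1 - q) ^ m)" if "d \<in> D" for d
  proof (rule prob_no_matching_pair_le[OF S q])
    show "inj_on (a d) {..<M}" using a[OF that that] by (auto simp: inj_on_def)
    show "inj_on (b d i) {..<m}" if "i < M" for i
      using b[OF \<open>d \<in> D\<close> \<open>d \<in> D\<close> that that] by (auto simp: inj_on_def)
  qed (use aS[OF that] bS[OF that] ab[OF that that] in auto)
  show "a d ` {..<M} \<union> (\<Union>i<M. b d i ` {..<m}) \<subseteq> S" if "d \<in> D" for d
    using aS[OF that] bS[OF that] by auto
qed (use assms(1,4) in auto)

section \<open>Cycles as cyclic vertex sequences\<close>

definition vertex_cycle :: "('a \<times> 'a) set \<Rightarrow> 'a list \<Rightarrow> bool" where
  "vertex_cycle E xs \<longleftrightarrow> xs \<noteq> [] \<and> distinct xs \<and>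
     successively (\<lambda>u v. (u, v) \<in> E) xs \<and> (last xs, hd xs) \<in> E"

lemma vertex_cycle_mono: "vertex_cycle E xs \<Longrightarrow> E \<subseteq> E' \<Longrightarrow> vertex_cycle E' xs"
  unfolding vertex_cycle_def by (auto intro: successively_mono)

lemma vertex_cycle_arc:
  assumes "vertex_cycle E xs" "Suc i < length xs"
  shows "(xs ! i, xs ! Suc i) \<in> E"
  using assms unfolding vertex_cycle_def by (auto simp: successively_conv_nth)

lemma set_vertex_cycle:
  assumes "vertex_cycle E xs"
  shows "set xs \<subseteq> Range E"
proof
  fix x assume "x \<in> set xs"
  then obtain i where i: "i < length xs" "x = xs ! i" by (auto simp: in_set_conv_nth)
  show "x \<in> Range E"
  proof (cases i)
    case 0
    then show ?thesis using assms i by (auto simp: vertex_cycle_def hd_conv_nth)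
  next
    case (Suc j)
    then show ?thesis using vertex_cycle_arc[OF assms, of j] i by auto
  qed
qed

lemma pawalk_verts_map: "pcas u p v \<Longrightarrow> pawalk_verts u p = map fst p @ [v]"
  by (induction p arbitrary: u) auto

lemma successively_of_pcas:
  "pcas u p v \<Longrightarrow> set p \<subseteq> E \<Longrightarrow> successively (\<lambda>u v. (u, v) \<in> E) (pawalk_verts u p)"
proof (induction p arbitrary: u)
  case (Cons e p)
  have "hd (pawalk_verts (snd e) p) = snd e" using Cons.prems by (cases p) auto
  with Cons show ?case by (auto simp: successively_Cons)
qed auto

text \<open>
  The arcs of a closed walk are recovered from its vertex sequence by pairing each vertex with the
  next one.
\<close>
lemma pcas_of_successively:
  assumes "xs \<noteq> []" "successively (\<lambda>u v. (u, v) \<in> E) (xs @ [v])"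
  shows "pcas (hd xs) (zip xs (tl xs @ [v])) v \<and> set (zip xs (tl xs @ [v])) \<subseteq> E"
  using assms
proof (induction xs)
  case (Cons x xs)
  then show ?case by (cases xs) auto
qed auto

text \<open>
  Cyclic vertex sequences are more convenient than arc walks for cutting a cycle into segments and
  reassembling them; both descriptions give the same lengths.
\<close>
lemma cycle_lengths_vertex_cycle:
  assumes "parcs G \<subseteq> pverts G \<times> pverts G"
  shows "{length p |p. pre_digraph.cycle (with_proj G) p \<and> l \<le> length p} =
         {length xs |xs. vertex_cycle (parcs G) xs \<and> l \<le> length xs}"
proof (intro equalityI subsetI)
  fix k assume "k \<in> {length p |p. pre_digraph.cycle (with_proj G) p \<and> l \<le> length p}"
  then obtain p u where p: "k = length p" "l \<le> length p" "p \<noteq> []" "set p \<subseteq> parcs G"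
      "pcas u p u" "distinct (tl (pawalk_verts u p))"
    by (auto simp: pre_digraph.cycle_def pre_digraph.awalk_def cas_with_proj_eq awalk_verts_with_proj_eq)
  have v: "pawalk_verts u p = map fst p @ [u]" using pawalk_verts_map[OF p(5)] .
  have succ: "successively (\<lambda>u v. (u, v) \<in> parcs G) (map fst p @ [u])"
    using successively_of_pcas[OF p(5,4)] v by simp
  have "hd (map fst p) = u" using p(3,5) by (cases p) auto
  moreover have "distinct (map fst p)"
  proof -
    have "mset (map fst p @ [u]) = mset (u # tl (map fst p @ [u]))"
      using p(3) \<open>hd (map fst p) = u\<close> by (cases p) auto
    then have "mset (map fst p) = mset (tl (pawalk_verts u p))" unfolding v by simp
    with p(6) show ?thesis by (metis mset_eq_imp_distinct_iff)
  qed
  ultimately have "vertex_cycle (parcs G) (map fst p)"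
    using succ p(3) unfolding vertex_cycle_def by (auto simp: successively_append_iff)
  then show "k \<in> {length xs |xs. vertex_cycle (parcs G) xs \<and> l \<le> length xs}"
    using p(1,2) by (metis (mono_tags, lifting) length_map mem_Collect_eq)
next
  fix k assume "k \<in> {length xs |xs. vertex_cycle (parcs G) xs \<and> l \<le> length xs}"
  then obtain xs where xs: "k = length xs" "l \<le> length xs" "vertex_cycle (parcs G) xs" by auto
  define p where "p = zip xs (tl xs @ [hd xs])"
  have ne: "xs \<noteq> []" and d: "distinct xs" and
      s: "successively (\<lambda>u v. (u, v) \<in> parcs G) (xs @ [hd xs])"
    using xs(3) by (auto simp: vertex_cycle_def successively_append_iff)
  have len: "length p = length xs" using ne by (simp add: p_def)
  have cas: "pcas (hd xs) p (hd xs)" and sub: "set p \<subseteq> parcs G"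
    using pcas_of_successively[OF ne s] by (auto simp: p_def)
  have "map fst p = xs" using ne by (simp add: p_def)
  then have "tl (pawalk_verts (hd xs) p) = tl xs @ [hd xs]"
    using pawalk_verts_map[OF cas] ne by simp
  moreover have "distinct (tl xs @ [hd xs])" using d ne by (cases xs) auto
  moreover have "hd xs \<in> pverts G"
    using set_vertex_cycle[OF xs(3)] ne assms hd_in_set[OF ne] by blast
  moreover have "p \<noteq> []" using len ne by auto
  ultimately have "pre_digraph.cycle (with_proj G) p"
    using cas sub
    by (auto simp: pre_digraph.cycle_def pre_digraph.awalk_def cas_with_proj_eq awalk_verts_with_proj_eq)
  then show "k \<in> {length p |p. pre_digraph.cycle (with_proj G) p \<and> l \<le> length p}"
    using len xs by (metis (mono_tags, lifting) mem_Collect_eq)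
qed

lemma successively_segment:
  assumes "vertex_cycle E xs" "j \<le> length xs"
  shows "successively (\<lambda>u v. (u, v) \<in> E) (map ((!) xs) [i..<j])"
  using assms vertex_cycle_arc[OF assms(1)] by (auto simp: successively_conv_nth)

lemma vertex_cycle_two_segments:
  assumes "vertex_cycle E xs" "z \<le> u" "u < v" "v \<le> w" "w < length xs"
    and "(xs ! u, xs ! v) \<in> E" "(xs ! w, xs ! z) \<in> E"
  shows "vertex_cycle E (map ((!) xs) ([z..<Suc u] @ [v..<Suc w]))"
  unfolding vertex_cycle_def
proof (intro conjI)
  have "distinct xs" using assms(1) by (simp add: vertex_cycle_def)
  then show "distinct (map ((!) xs) ([z..<Suc u] @ [v..<Suc w]))"
    using assms(2-5) by (auto simp: distinct_map inj_on_def nth_eq_iff_index_eq)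
  show "successively (\<lambda>u v. (u, v) \<in> E) (map ((!) xs) ([z..<Suc u] @ [v..<Suc w]))"
    unfolding map_append successively_append_iff
    using assms successively_segment[OF assms(1), of "Suc u" z]
      successively_segment[OF assms(1), of "Suc w" v]
    by (auto simp: last_map hd_map simp del: upt_Suc)
qed (use assms in \<open>auto simp: last_map hd_append hd_map simp del: upt_Suc\<close>)

lemma vertex_cycle_three_segments:
  assumes "vertex_cycle E xs" "u < v" "v \<le> w" "w < z" "z < length xs"
    and "(xs ! u, xs ! v) \<in> E" "(xs ! w, xs ! z) \<in> E"
  shows "vertex_cycle E (map ((!) xs) ([0..<Suc u] @ [v..<Suc w] @ [z..<length xs]))"
  unfolding vertex_cycle_def
proof (intro conjI)
  have ne: "xs \<noteq> []" and "distinct xs" using assms(1) by (auto simp: vertex_cycle_def)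
  then show "distinct (map ((!) xs) ([0..<Suc u] @ [v..<Suc w] @ [z..<length xs]))"
    using assms(2-5) by (auto simp: distinct_map inj_on_def nth_eq_iff_index_eq)
  show "successively (\<lambda>u v. (u, v) \<in> E) (map ((!) xs) ([0..<Suc u] @ [v..<Suc w] @ [z..<length xs]))"
    unfolding map_append successively_append_iff
    using assms ne hd_upt[OF assms(5)] successively_segment[OF assms(1), of "Suc u" 0]
      successively_segment[OF assms(1), of "Suc w" v]
      successively_segment[OF assms(1), of "length xs" z]
    by (auto simp: last_map hd_map hd_append simp del: upt_Suc)
  have "(last xs, hd xs) \<in> E" using assms(1) by (auto simp: vertex_cycle_def)
  moreover have "last (map ((!) xs) ([0..<Suc u] @ [v..<Suc w] @ [z..<length xs])) = last xs"
  proof -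
    have "last (map ((!) xs) [z..<length xs]) = xs ! (length xs - 1)"
      using assms(5) by (subst last_map) auto
    then show ?thesis using assms(5) ne by (simp add: last_conv_nth[OF ne] del: upt_Suc)
  qed
  moreover have "hd (map ((!) xs) ([0..<Suc u] @ [v..<Suc w] @ [z..<length xs])) = hd xs"
    using ne by (auto simp: hd_append hd_map hd_conv_nth simp del: upt_Suc)
  ultimately show "(last (map ((!) xs) ([0..<Suc u] @ [v..<Suc w] @ [z..<length xs])),
         hd (map ((!) xs) ([0..<Suc u] @ [v..<Suc w] @ [z..<length xs]))) \<in> E" by simp
qed auto

section \<open>Cycles of a given length from random chords\<close>

text \<open>
  Each ordered pair of distinct vertices looks up the Boolean variable named by its label; a label
  shared by both orientations of a pair models an undirected edge.
\<close>
definition arcs_of :: "nat \<Rightarrow> (nat \<times> nat \<Rightarrow> 'i) \<Rightarrow> ('i \<Rightarrow> bool) \<Rightarrow> (nat \<times> nat) set" where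
  "arcs_of n lab X = {(u, v). u < n \<and> v < n \<and> u \<noteq> v \<and> X (lab (u, v))}"

locale pair_labelling =
  fixes n :: nat and lab :: "nat \<times> nat \<Rightarrow> 'i" and S :: "'i set"
  assumes finite_labels: "finite S"
    and lab_in: "u < n \<Longrightarrow> v < n \<Longrightarrow> u \<noteq> v \<Longrightarrow> lab (u, v) \<in> S"
    and lab_eq: "lab (u, v) = lab (u', v') \<Longrightarrow> {u, v} = {u', v'}"
begin

text \<open>
  Throughout, \<open>xs\<close> is a cycle of a fixed graph \<open>H\<close> and the variables \<open>X\<close> describe the sprinkled
  arcs.  Chords are described by the positions of their ends on \<open>xs\<close>.  The number \<open>K\<close> is the unit
  in which positions are measured: twelve units of room suffice for both shapes of chord pairs.
\<close>
context
  fixes H xs and K k :: nat and q :: real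
  assumes H: "vertex_cycle H xs" and xs: "set xs \<subseteq> {..<n}"
    and K: "K = length xs div 12" and q: "0 \<le> q" "q \<le> 1"
begin

lemma chord_in: "i < length xs \<Longrightarrow> j < length xs \<Longrightarrow> i \<noteq> j \<Longrightarrow> lab (xs ! i, xs ! j) \<in> S"
  using xs H by (intro lab_in) (auto simp: vertex_cycle_def nth_eq_iff_index_eq dest: nth_mem)

lemma chord_eq:
  assumes "lab (xs ! i, xs ! j) = lab (xs ! i', xs ! j')"
    and "i < length xs" "j < length xs" "i' < length xs" "j' < length xs"
  shows "i = i' \<and> j = j' \<or> i = j' \<and> j = i'"
  using lab_eq[OF assms(1)] assms(2-) H
  by (auto simp: vertex_cycle_def doubleton_eq_iff nth_eq_iff_index_eq)

lemma chord_arc: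
  assumes "i < length xs" "j < length xs" "i \<noteq> j" "X (lab (xs ! i, xs ! j))"
  shows "(xs ! i, xs ! j) \<in> H \<union> arcs_of n lab X"
  using assms xs H by (auto simp: arcs_of_def vertex_cycle_def nth_eq_iff_index_eq dest: nth_mem)

lemma cycle_with_chords: "vertex_cycle (H \<union> arcs_of n lab X) xs"
  using H by (rule vertex_cycle_mono) auto

text \<open>
  Nested chords.  Segments \<open>[z..u]\<close> and \<open>[v..w]\<close> with \<open>v = u + d\<close> contain \<open>k\<close> vertices in total
  exactly when \<open>w - z = d + (k - 2)\<close>.  The blocks are indexed by \<open>d\<close>, the first chord by \<open>u\<close> and the
  second by \<open>z\<close>.  As \<open>d + (k - 2)\<close> may itself be the span of a first chord in another block, taking
  \<open>u\<close> even and \<open>z\<close> odd keeps the two kinds of chords apart.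
\<close>
lemma prob_no_short_cycle_le:
  assumes k: "2 \<le> k" "k \<le> 4 * K"
  shows "measure_pmf.prob (Pi_pmf S False (\<lambda>_. bernoulli_pmf q))
           {X. \<nexists>ys. vertex_cycle (H \<union> arcs_of n lab X) ys \<and> length ys = k}
         \<le> (1 - (1 - (1 - q) ^ K) * (1 - (1 - q) ^ ((k - 2) div 2))) ^ K"
proof -
  define m where "m = (k - 2) div 2"
  define u where "u i = 4 * K + 2 * i" for i
  define z where "z i j = 4 * K + 2 * i - 1 - 2 * j" for i j
  define w where "w d i j = z i j + d + (k - 2)" for d i j
  define a where "a d i = lab (xs ! u i, xs ! (u i + d))" for d i
  define b where "b d i j = lab (xs ! w d i j, xs ! z i j)" for d i j
  \<comment> \<open>Since \<open>4 K \<le> u < 6 K\<close>, there is room for \<open>z \<ge> u - (k - 2)\<close> below and for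
      \<open>w < u + d + (k - 2) < 11 K\<close> above.\<close>
  have L: "12 * K \<le> length xs" using K by simp
  have ua: "u i + d < length xs" if "d \<in> {1..K}" "i < K" for d i
    using that L by (auto simp: u_def)
  have wz: "w d i j < length xs" "z i j < u i" "u i + d \<le> w d i j" "z i j < w d i j"
      "Suc (u i) - z i j + (Suc (w d i j) - (u i + d)) = k" "odd (z i j)" "z i j = u i - 1 - 2 * j" "2 * j + 4 \<le> u i"
    if "d \<in> {1..K}" "i < K" "j < m" for d i j
  proof -
    have "2 * j + 4 \<le> k" using that(3) unfolding m_def by linarith
    with that k L show "w d i j < length xs" "z i j < u i" "u i + d \<le> w d i j" "z i j < w d i j"
      "Suc (u i) - z i j + (Suc (w d i j) - (u i + d)) = k" "2 * j + 4 \<le> u i"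
      by (auto simp: u_def z_def w_def)
    from that k \<open>2 * j + 4 \<le> k\<close> have "z i j = 2 * (2 * K + i - 1 - j) + 1" by (auto simp: z_def)
    then show "odd (z i j)" by simp
    show "z i j = u i - 1 - 2 * j" by (simp add: u_def z_def)
  qed
  have even_u: "even (u i)" for i by (simp add: u_def)
  have "{X. \<nexists>ys. vertex_cycle (H \<union> arcs_of n lab X) ys \<and> length ys = k}
        \<subseteq> {X. \<forall>d\<in>{1..K}. \<forall>i<K. X (a d i) \<longrightarrow> (\<forall>j<m. \<not> X (b d i j))}"
  proof clarify
    fix X d i j
    assume no: "\<nexists>ys. vertex_cycle (H \<union> arcs_of n lab X) ys \<and> length ys = k"
      and d: "d \<in> {1..K}" "i < K" "X (a d i)" "j < m" "X (b d i j)"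
    note wz = wz[OF d(1,2,4)] and ua = ua[OF d(1,2)]
    have "vertex_cycle (H \<union> arcs_of n lab X)
        (map ((!) xs) ([z i j..<Suc (u i)] @ [u i + d..<Suc (w d i j)]))"
      using d wz ua
      by (intro vertex_cycle_two_segments cycle_with_chords chord_arc) (auto simp: a_def b_def)
    moreover have "length (map ((!) xs) ([z i j..<Suc (u i)] @ [u i + d..<Suc (w d i j)])) = k"
      using wz(5) by (simp del: upt_Suc)
    ultimately show False using no by blast
  qed
  then have "measure_pmf.prob (Pi_pmf S False (\<lambda>_. bernoulli_pmf q))
           {X. \<nexists>ys. vertex_cycle (H \<union> arcs_of n lab X) ys \<and> length ys = k} \<le>
      measure_pmf.prob (Pi_pmf S False (\<lambda>_. bernoulli_pmf q))
           {X. \<forall>d\<in>{1..K}. \<forall>i<K. X (a d i) \<longrightarrow> (\<forall>j<m. \<not> X (b d i j))}"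
    by (intro measure_pmf.finite_measure_mono) auto
  also have "\<dots> \<le> (1 - (1 - (1 - q) ^ K) * (1 - (1 - q) ^ m)) ^ card {1..K}"
  proof (rule prob_no_matching_pair_in_blocks_le[OF finite_labels q])
    show "a d i \<in> S" if "d \<in> {1..K}" "i < K" for d i
      unfolding a_def using ua[OF that] that by (intro chord_in) auto
    show "b d i j \<in> S" if "d \<in> {1..K}" "i < K" "j < m" for d i j
      unfolding b_def using wz[OF that] by (intro chord_in) auto
    show "d = d' \<and> i = i'"
      if "d \<in> {1..K}" "d' \<in> {1..K}" "i < K" "i' < K" "a d i = a d' i'" for d d' i i'
      using chord_eq[OF that(5)[unfolded a_def]] ua[OF that(1,3)] ua[OF that(2,4)] that
      by (auto simp: u_def)
    show "d = d' \<and> (i = i' \<longrightarrow> j = j')"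
      if "d \<in> {1..K}" "d' \<in> {1..K}" "i < K" "i' < K" "j < m" "j' < m" "b d i j = b d' i' j'"
      for d d' i i' j j'
    proof -
      note W = wz[OF that(1,3,5)] and W' = wz[OF that(2,4,6)]
      have "w d i j = w d' i' j' \<and> z i j = z i' j'"
        using chord_eq[OF that(7)[unfolded b_def]] W(1,4) W'(1,4) by linarith
      then show ?thesis using W(7,8) W'(7,8) by (auto simp: w_def)
    qed
    show "a d i \<noteq> b d' i' j"
      if "d \<in> {1..K}" "d' \<in> {1..K}" "i < K" "i' < K" "j < m" for d d' i i' j
    proof
      assume "a d i = b d' i' j"
      note W = wz[OF that(2,4,5)] and U = ua[OF that(1,3)]
      have "u i = z i' j"
        using chord_eq[OF \<open>a d i = b d' i' j\<close>[unfolded a_def b_def]] W(1,4) U that(1) by auto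
      with W(6) even_u show False by metis
    qed
  qed auto
  finally show ?thesis by (simp add: m_def)
qed

text \<open>
  Disjoint chords.  Jumping from \<open>i\<close> to \<open>i + d\<close> and later from \<open>w\<close> to \<open>w + g\<close> skips
  \<open>(d - 1) + (g - 1)\<close> vertices, which leaves \<open>k\<close> of them exactly when \<open>d + g = L - k + 2\<close>.  Here the
  first chords start in \<open>[0, K)\<close> and the second ones in \<open>[2 K, 3 K)\<close>.  As \<open>L - k\<close> is below
  \<open>8 K + 12\<close>, bounding \<open>d\<close> by a ninth of it gives \<open>d \<le> K\<close>, so that the jumps do not overlap, while
  \<open>K \<ge> 12\<close> absorbs the rounding and keeps the second jump within the cycle.
\<close>
lemma prob_no_long_cycle_le:
  assumes k: "4 * K < k" "k \<le> length xs" and K12: "12 \<le> K"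
  shows "measure_pmf.prob (Pi_pmf S False (\<lambda>_. bernoulli_pmf q))
           {X. \<nexists>ys. vertex_cycle (H \<union> arcs_of n lab X) ys \<and> length ys = k}
         \<le> (1 - (1 - (1 - q) ^ K) * (1 - (1 - q) ^ K)) ^ ((length xs - k) div 9)"
proof -
  define D where "D = {1..(length xs - k) div 9}"
  define g where "g d = length xs - k + 2 - d" for d
  define a where "a d i = lab (xs ! i, xs ! (i + d))" for d i
  define b where "b d i j = lab (xs ! (2 * K + j), xs ! (2 * K + j + g d))" for d i j :: nat
  have L: "12 * K \<le> length xs" "length xs \<le> 12 * K + 11" using K by linarith+
  have D: "1 \<le> d" "d \<le> K" "d \<le> length xs - k" "g d \<le> length xs - k + 1" "0 < g d" if "d \<in> D" for d
    using that L K12 k by (auto simp: D_def g_def)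
  have wz: "2 * K + j + g d < length xs" if "d \<in> D" "j < K" for d j
    using D[OF that(1)] that(2) L K12 k by linarith
  have "{X. \<nexists>ys. vertex_cycle (H \<union> arcs_of n lab X) ys \<and> length ys = k}
        \<subseteq> {X. \<forall>d\<in>D. \<forall>i<K. X (a d i) \<longrightarrow> (\<forall>j<K. \<not> X (b d i j))}"
  proof clarify
    fix X d i j
    assume no: "\<nexists>ys. vertex_cycle (H \<union> arcs_of n lab X) ys \<and> length ys = k"
      and d: "d \<in> D" "i < K" "X (a d i)" "j < K" "X (b d i j)"
    note wz = wz[OF d(1,4)] and D = D[OF d(1)]
    have "vertex_cycle (H \<union> arcs_of n lab X)
        (map ((!) xs) ([0..<Suc i] @ [i + d..<Suc (2 * K + j)] @ [2 * K + j + g d..<length xs]))"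
      using d wz D
      by (intro vertex_cycle_three_segments cycle_with_chords chord_arc) (auto simp: a_def b_def)
    moreover have "Suc i + (Suc (2 * K + j) - (i + d)) + (length xs - (2 * K + j + g d)) = k"
      using d wz D k by (simp add: g_def)
    then have "length (map ((!) xs)
        ([0..<Suc i] @ [i + d..<Suc (2 * K + j)] @ [2 * K + j + g d..<length xs])) = k"
      by (simp del: upt_Suc)
    ultimately show False using no by blast
  qed
  then have "measure_pmf.prob (Pi_pmf S False (\<lambda>_. bernoulli_pmf q))
           {X. \<nexists>ys. vertex_cycle (H \<union> arcs_of n lab X) ys \<and> length ys = k} \<le>
      measure_pmf.prob (Pi_pmf S False (\<lambda>_. bernoulli_pmf q))
           {X. \<forall>d\<in>D. \<forall>i<K. X (a d i) \<longrightarrow> (\<forall>j<K. \<not> X (b d i j))}"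
    by (intro measure_pmf.finite_measure_mono) auto
  also have "\<dots> \<le> (1 - (1 - (1 - q) ^ K) * (1 - (1 - q) ^ K)) ^ card D"
  proof (rule prob_no_matching_pair_in_blocks_le[OF finite_labels q])
    show "finite D" by (simp add: D_def)
    show "a d i \<in> S" if "d \<in> D" "i < K" for d i
      unfolding a_def using D[OF that(1)] that L by (intro chord_in) auto
    show "b d i j \<in> S" if "d \<in> D" "i < K" "j < K" for d i j
      unfolding b_def using wz[OF that(1,3)] D[OF that(1)] by (intro chord_in) auto
    show "d = d' \<and> i = i'"
      if "d \<in> D" "d' \<in> D" "i < K" "i' < K" "a d i = a d' i'" for d d' i i'
      using chord_eq[OF that(5)[unfolded a_def]] D[OF that(1)] D[OF that(2)] that L by auto
    show "d = d' \<and> (i = i' \<longrightarrow> j = j')"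
      if "d \<in> D" "d' \<in> D" "i < K" "i' < K" "j < K" "j' < K" "b d i j = b d' i' j'"
      for d d' i i' j j'
    proof -
      have "j = j' \<and> g d = g d'"
        using chord_eq[OF that(7)[unfolded b_def]] wz[OF that(1,5)] wz[OF that(2,6)]
          D(5)[OF that(1)] D(5)[OF that(2)] by auto
      then show ?thesis using D(3)[OF that(1)] D(3)[OF that(2)] by (auto simp: g_def)
    qed
    show "a d i \<noteq> b d' i' j"
      if "d \<in> D" "d' \<in> D" "i < K" "i' < K" "j < K" for d d' i i' j
    proof
      assume "a d i = b d' i' j"
      then show False
        using chord_eq[OF \<open>a d i = b d' i' j\<close>[unfolded a_def b_def]] D[OF that(1)]
          wz[OF that(2,5)] that L by auto
    qed
  qed
  finally show ?thesis by (simp add: D_def)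
qed

end

end

section \<open>Geometric decay of the failure probabilities\<close>

text \<open>
  Turns exponential decay in a rounded quotient \<open>j\<close> of \<open>m\<close> into geometric decay in \<open>m\<close>; the constant
  factor pays for the rounding error \<open>t\<close>.
\<close>
lemma exp_floor_le:
  fixes c b :: real and m j :: nat
  assumes "0 \<le> c" "real m / b - t \<le> real j"
  shows "exp (- c * real j) \<le> exp (c * t) * exp (- (c / b)) ^ m"
proof -
  have "- c * real j \<le> c * t + real m * (- (c / b))"
    using mult_left_mono[OF assms(2,1)] by (simp add: algebra_simps)
  then have "exp (- c * real j) \<le> exp (c * t + real m * (- (c / b)))" by simp
  then show ?thesis by (simp only: exp_add exp_of_nat_mult)
qed

text \<open>
  A linear lower bound on the probability of at least one success, valid because the expected number
  \<open>x\<close> of successes stays bounded by \<open>e\<close>.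
\<close>
lemma one_minus_exp_ge:
  fixes x e :: real
  assumes "0 \<le> x" "x \<le> e"
  shows "x / (1 + e) \<le> 1 - exp (- x)"
proof -
  have "exp (- x) \<le> 1 / (1 + x)"
    using exp_ge_add_one_self[of x] assms by (simp add: exp_minus field_simps)
  then have "x / (1 + x) \<le> 1 - exp (- x)" using assms by (simp add: field_simps)
  moreover have "x / (1 + e) \<le> x / (1 + x)" using assms by (intro divide_left_mono) auto
  ultimately show ?thesis by linarith
qed

text \<open>
  The two failure probabilities decay geometrically in \<open>k\<close> and in \<open>L - k\<close>, uniformly in \<open>n\<close>, \<open>L\<close>
  and \<open>q\<close>.  Since \<open>K\<close> is at least \<open>\<gamma> n / 24\<close>, the number \<open>\<beta> = 1 - exp (- \<epsilon> \<gamma> / 24)\<close> is a lower bound,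
  independent of \<open>n\<close>, on the probability that one of \<open>K\<close> chords is present.  A block for a long length
  then fails with probability at most \<open>exp (- \<beta>\<^sup>2)\<close>.  For a short length, with \<open>j\<close> second chords, it
  fails with probability at most \<open>exp (- \<beta> x / (1 + \<epsilon>))\<close> where \<open>x = \<epsilon> j / n\<close>, and \<open>K\<close> of these factors
  give \<open>exp (- c1 j)\<close>.  The threshold 288 makes \<open>K \<ge> 12\<close> and lets half of \<open>\<gamma> n / 12\<close> pay for rounding.
\<close>
lemma chord_failure_bounds:
  fixes \<epsilon> \<gamma> :: real
  assumes "\<epsilon> > 0" "\<gamma> > 0"
  obtains C s where "0 < C" "0 < s" "s < 1"
    and "\<forall>n L K k q. 288 \<le> \<gamma> * real n \<longrightarrow> \<gamma> * real n \<le> real L \<longrightarrow> L \<le> n \<longrightarrow> K = L div 12 \<longrightarrow>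
           \<epsilon> / real n \<le> q \<longrightarrow> q \<le> 1 \<longrightarrow> 2 \<le> k \<longrightarrow> k \<le> 4 * K \<longrightarrow>
           (1 - (1 - (1 - q) ^ K) * (1 - (1 - q) ^ ((k - 2) div 2))) ^ K \<le> C * s ^ k"
    and "\<forall>n L K k q. 288 \<le> \<gamma> * real n \<longrightarrow> \<gamma> * real n \<le> real L \<longrightarrow> L \<le> n \<longrightarrow> K = L div 12 \<longrightarrow>
           \<epsilon> / real n \<le> q \<longrightarrow> q \<le> 1 \<longrightarrow>
           (1 - (1 - (1 - q) ^ K) * (1 - (1 - q) ^ K)) ^ ((L - k) div 9) \<le> C * s ^ (L - k)"
proof -
  define \<beta> where "\<beta> = 1 - exp (- \<epsilon> * \<gamma> / 24)"
  define c1 where "c1 = \<beta> * \<epsilon> * \<gamma> / (24 * (1 + \<epsilon>))"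
  define c where "c = min (\<beta>\<^sup>2 / 9) (c1 / 2)"
  define C where "C = exp (\<beta>\<^sup>2) + exp (2 * c1)"
  have \<beta>: "0 < \<beta>" "\<beta> < 1" using assms by (auto simp: \<beta>_def)
  have c1: "0 < c1" using assms \<beta> by (auto simp: c1_def)
  have c: "0 < c" "c \<le> \<beta>\<^sup>2 / 9" "c \<le> c1 / 2" using \<beta> c1 by (auto simp: c_def)
  have power_le: "(1 - q) ^ j \<le> exp (- (\<epsilon> * real j / real n))"
    if "\<epsilon> / real n \<le> q" "q \<le> 1" for q n j
  proof -
    have "1 - q \<le> exp (- (\<epsilon> / real n))" using exp_ge_add_one_self[of "- (\<epsilon> / real n)"] that by linarith
    then have "(1 - q) ^ j \<le> exp (- (\<epsilon> / real n)) ^ j" using that by (intro power_mono) auto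
    also have "\<dots> = exp (- (\<epsilon> * real j / real n))" by (simp add: exp_of_nat_mult[symmetric] algebra_simps)
    finally show ?thesis .
  qed
  have K_ge: "\<gamma> * real n / 24 \<le> real K"
    if "288 \<le> \<gamma> * real n" "\<gamma> * real n \<le> real L" "K = L div 12" for n L K
  proof -
    have "real L \<le> 12 * real K + 11" using that(3) by linarith
    then show ?thesis using that(1,2) by linarith
  qed
  have n0: "0 < real n" if "288 \<le> \<gamma> * real n" for n using that assms(2) by (cases n) auto
  have first: "\<beta> \<le> 1 - (1 - q) ^ K"
    if "288 \<le> \<gamma> * real n" "\<gamma> * real n \<le> real L" "K = L div 12" "\<epsilon> / real n \<le> q" "q \<le> 1" for q n K L
  proof -
    have "\<epsilon> * \<gamma> / 24 \<le> \<epsilon> * real K / real n"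
      using mult_left_mono[OF K_ge[OF that(1,2,3)], of \<epsilon>] n0[OF that(1)] assms(1)
      by (simp add: field_simps)
    with power_le[OF that(4,5), of K] have "(1 - q) ^ K \<le> exp (- \<epsilon> * \<gamma> / 24)"
      by (smt (verit) exp_le_cancel_iff minus_mult_left divide_minus_left)
    then show ?thesis by (simp add: \<beta>_def)
  qed
  show ?thesis
  proof (rule that[of C "exp (- c)"]; (intro allI impI)?)
    show "0 < C" by (simp add: C_def add_pos_pos)
    show "exp (- c) < 1" using c by simp
  next
    fix n L K k :: nat and q :: real
    assume A: "288 \<le> \<gamma> * real n" "\<gamma> * real n \<le> real L" "L \<le> n" "K = L div 12"
      "\<epsilon> / real n \<le> q" "q \<le> 1" and k: "2 \<le> k" "k \<le> 4 * K"
    define j where "j = (k - 2) div 2"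
    define x where "x = \<epsilon> * real j / real n"
    note n = n0[OF A(1)]
    have q0: "0 \<le> q" using A(5) assms(1) n by (smt (verit) divide_pos_pos)
    have "j \<le> n" using k A(3,4) by (simp add: j_def)
    then have x: "0 \<le> x" "x \<le> \<epsilon>" using n assms(1) by (auto simp: x_def field_simps)
    have "x / (1 + \<epsilon>) \<le> 1 - (1 - q) ^ j"
      using one_minus_exp_ge[OF x] power_le[OF A(5,6), of j] by (simp add: x_def)
    then have "\<beta> * (x / (1 + \<epsilon>)) \<le> (1 - (1 - q) ^ K) * (1 - (1 - q) ^ j)"
      using first[OF A(1,2,4,5,6)] \<beta> x assms(1) by (intro mult_mono) auto
    then have "1 - (1 - (1 - q) ^ K) * (1 - (1 - q) ^ j) \<le> exp (- (\<beta> * (x / (1 + \<epsilon>))))"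
      using exp_ge_add_one_self[of "- (\<beta> * (x / (1 + \<epsilon>)))"] by linarith
    moreover have "0 \<le> 1 - (1 - (1 - q) ^ K) * (1 - (1 - q) ^ j)"
      using mult_le_one[of "1 - (1 - q) ^ K" "1 - (1 - q) ^ j"] q0 A(6) by (simp add: power_le_one)
    ultimately have "(1 - (1 - (1 - q) ^ K) * (1 - (1 - q) ^ j)) ^ K
        \<le> exp (- (\<beta> * (x / (1 + \<epsilon>)))) ^ K" by (rule power_mono)
    also have "\<dots> = exp (- (\<beta> * (x / (1 + \<epsilon>)) * real K))"
      by (simp add: exp_of_nat_mult[symmetric] algebra_simps)
    also have "\<dots> \<le> exp (- c1 * real j)"
    proof -
      have "\<epsilon> * real j * (\<gamma> / 24) \<le> x * real K"
        using mult_left_mono[OF K_ge[OF A(1,2,4)], of "\<epsilon> * real j"] n assms(1)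
        by (simp add: x_def field_simps)
      then have "\<beta> / (1 + \<epsilon>) * (\<epsilon> * real j * (\<gamma> / 24)) \<le> \<beta> / (1 + \<epsilon>) * (x * real K)"
        using \<beta> assms(1) by (intro mult_left_mono) auto
      moreover have "\<beta> / (1 + \<epsilon>) * (\<epsilon> * real j * (\<gamma> / 24)) = c1 * real j"
        by (simp add: c1_def ac_simps)
      ultimately show ?thesis by (simp add: mult.assoc)
    qed
    also have "\<dots> \<le> exp (c1 * 2) * exp (- (c1 / 2)) ^ k"
    proof (rule exp_floor_le)
      show "real k / 2 - 2 \<le> real j" unfolding j_def using k by linarith
    qed (use c1 in simp)
    also have "\<dots> \<le> C * exp (- c) ^ k"
      using c by (intro mult_mono power_mono) (auto simp: C_def mult.commute)
    finally show "(1 - (1 - (1 - q) ^ K) * (1 - (1 - q) ^ ((k - 2) div 2))) ^ K \<le> C * exp (- c) ^ k"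
      by (simp add: j_def)
  next
    fix n L K k :: nat and q :: real
    assume A: "288 \<le> \<gamma> * real n" "\<gamma> * real n \<le> real L" "L \<le> n" "K = L div 12"
      "\<epsilon> / real n \<le> q" "q \<le> 1"
    have q0: "0 \<le> q" using A(5) assms(1) n0[OF A(1)] by (smt (verit) divide_pos_pos)
    have "\<beta>\<^sup>2 \<le> (1 - (1 - q) ^ K) * (1 - (1 - q) ^ K)"
      unfolding power2_eq_square using first[OF A(1,2,4,5,6)] \<beta> by (intro mult_mono) auto
    then have "1 - (1 - (1 - q) ^ K) * (1 - (1 - q) ^ K) \<le> exp (- \<beta>\<^sup>2)"
      using exp_ge_add_one_self[of "- \<beta>\<^sup>2"] by linarith
    moreover have "0 \<le> 1 - (1 - (1 - q) ^ K) * (1 - (1 - q) ^ K)"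
      using mult_le_one[of "1 - (1 - q) ^ K" "1 - (1 - q) ^ K"] q0 A(6) by (simp add: power_le_one)
    ultimately have "(1 - (1 - (1 - q) ^ K) * (1 - (1 - q) ^ K)) ^ ((L - k) div 9)
        \<le> exp (- \<beta>\<^sup>2) ^ ((L - k) div 9)" by (rule power_mono)
    also have "\<dots> = exp (- \<beta>\<^sup>2 * real ((L - k) div 9))"
      by (simp add: exp_of_nat_mult[symmetric] algebra_simps)
    also have "\<dots> \<le> exp (\<beta>\<^sup>2 * 1) * exp (- (\<beta>\<^sup>2 / 9)) ^ (L - k)"
    proof (rule exp_floor_le)
      show "real (L - k) / 9 - 1 \<le> real ((L - k) div 9)" by linarith
    qed simp
    also have "\<dots> \<le> C * exp (- c) ^ (L - k)"
      using c by (intro mult_mono power_mono) (auto simp: C_def)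
    finally show "(1 - (1 - (1 - q) ^ K) * (1 - (1 - q) ^ K)) ^ ((L - k) div 9) \<le> C * exp (- c) ^ (L - k)" .
  qed simp
qed

lemma sum_powers_le:
  fixes s :: real
  assumes "0 < s" "s < 1" "finite T" "inj_on f T" "\<And>k. k \<in> T \<Longrightarrow> a \<le> f k"
  shows "(\<Sum>k\<in>T. s ^ f k) \<le> s ^ a / (1 - s)"
proof -
  have "(\<Sum>k\<in>T. s ^ f k) = s ^ a * (\<Sum>k\<in>T. s ^ (f k - a))"
    unfolding sum_distrib_left using assms(5) by (intro sum.cong) (auto simp: power_add[symmetric])
  also have "(\<Sum>k\<in>T. s ^ (f k - a)) = (\<Sum>j\<in>(\<lambda>k. f k - a) ` T. s ^ j)"
    by (subst sum.reindex) (use assms(4,5) in \<open>auto simp: inj_on_def dest: eq_diff_iff[THEN iffD1, rotated 2]\<close>)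
  also have "\<dots> \<le> (\<Sum>j. s ^ j)"
    using assms(1-3) by (intro sum_le_suminf) (auto intro: summable_geometric)
  also have "\<dots> = 1 / (1 - s)" using assms(1,2) by (intro suminf_geometric) auto
  finally show ?thesis using assms(1) by (simp add: mult_left_mono)
qed

section \<open>Sprinkling\<close>

lemma Pi_pmf_bernoulli_sprinkle:
  assumes "finite S" "0 \<le> p" "p \<le> 1" "0 \<le> q" "q \<le> 1" "r = p + (1 - p) * q"
  shows "Pi_pmf S False (\<lambda>_. bernoulli_pmf r) =
    bind_pmf (Pi_pmf S False (\<lambda>_. bernoulli_pmf p)) (\<lambda>X.
      map_pmf (\<lambda>Y e. e \<in> S \<and> (X e \<or> Y e)) (Pi_pmf S False (\<lambda>_. bernoulli_pmf q)))"
proof -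
  have r: "0 \<le> r" "r \<le> 1"
    using assms mult_nonneg_nonneg[of "1 - p" q] mult_left_le[of q "1 - p"] by auto
  have "bernoulli_pmf r =
      bind_pmf (bernoulli_pmf p) (\<lambda>x. bind_pmf (bernoulli_pmf q) (\<lambda>y. return_pmf (x \<or> y)))"
    (is "_ = ?rhs")
  proof (rule pmf_eqI)
    fix b show "pmf (bernoulli_pmf r) b = pmf ?rhs b"
      using assms r by (cases b) (auto simp: pmf_bind algebra_simps)
  qed
  moreover have "((e \<in> S \<longrightarrow> P) \<and> e \<in> S) = (e \<in> S \<and> P)" for e P by auto
  ultimately show ?thesis
    using assms(1) by (simp add: Pi_pmf_bind[where d' = False] map_pmf_def)
qed

text \<open>
  A bad outcome is charged to the first round if that round is not good, and otherwise to the second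
  round, whose randomness is independent of the first.
\<close>
lemma prob_sprinkle_le:
  fixes Good Bad :: "('i \<Rightarrow> bool) \<Rightarrow> bool"
  assumes "finite S" "0 \<le> p" "p \<le> 1" "0 \<le> q" "q \<le> 1" "r = p + (1 - p) * q" "0 \<le> \<delta>"
    and Bad: "\<And>X. Good X \<Longrightarrow> measure_pmf.prob (Pi_pmf S False (\<lambda>_. bernoulli_pmf q))
                {Y. Bad (\<lambda>e. e \<in> S \<and> (X e \<or> Y e))} \<le> \<delta>"
  shows "measure_pmf.prob (Pi_pmf S False (\<lambda>_. bernoulli_pmf r)) {X. Bad X}
       \<le> measure_pmf.prob (Pi_pmf S False (\<lambda>_. bernoulli_pmf p)) {X. \<not> Good X} + \<delta>"
proof -
  define M N where "M = Pi_pmf S False (\<lambda>_. bernoulli_pmf p)"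
    and "N = Pi_pmf S False (\<lambda>_. bernoulli_pmf q)"
  have "emeasure (map_pmf (\<lambda>Y e. e \<in> S \<and> (X e \<or> Y e)) N) {X. Bad X}
      \<le> indicator {X. \<not> Good X} X + ennreal \<delta>" for X
  proof (cases "Good X")
    case True
    then show ?thesis using Bad[OF True]
      by (simp add: N_def measure_pmf.emeasure_eq_measure vimage_def ennreal_leI)
  next
    case False
    have "emeasure (map_pmf (\<lambda>Y e. e \<in> S \<and> (X e \<or> Y e)) N) {X. Bad X} \<le> 1"
      by (rule measure_pmf.emeasure_le_1)
    also have "1 \<le> 1 + ennreal \<delta>" by simp
    finally show ?thesis using False by (simp only: indicator_simps mem_Collect_eq not_False_eq_True)
  qed
  then have "emeasure (Pi_pmf S False (\<lambda>_. bernoulli_pmf r)) {X. Bad X}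
      \<le> (\<integral>\<^sup>+X. (indicator {X. \<not> Good X} X + ennreal \<delta>) \<partial>measure_pmf M)"
    unfolding Pi_pmf_bernoulli_sprinkle[OF assms(1-6)] emeasure_bind_pmf M_def[symmetric] N_def[symmetric]
    by (intro nn_integral_mono) auto
  also have "\<dots> = emeasure M {X. \<not> Good X} + ennreal \<delta>"
    by (subst nn_integral_add) auto
  finally show ?thesis
    using assms(7) by (simp add: M_def measure_pmf.emeasure_eq_measure ennreal_plus[symmetric] del: ennreal_plus)
qed

section \<open>All cycle lengths with high probability\<close>

text \<open>
  Union bound over the lengths.  Adding both bounds for every length avoids splitting the sum at
  \<open>4 K\<close>, and each of the two resulting sums runs over distinct exponents that are at least \<open>a\<close>.
\<close>
lemma (in pair_labelling) prob_missing_cycle_length_le: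
  assumes H: "vertex_cycle H xs" "set xs \<subseteq> {..<n}" and q: "0 \<le> q" "q \<le> 1"
    and K: "12 \<le> length xs div 12" and a: "2 \<le> a" and s: "0 < s" "s < 1" "0 < C"
    and short: "\<And>k. 2 \<le> k \<Longrightarrow> k \<le> 4 * (length xs div 12) \<Longrightarrow>
      (1 - (1 - (1 - q) ^ (length xs div 12)) * (1 - (1 - q) ^ ((k - 2) div 2))) ^ (length xs div 12) \<le> C * s ^ k"
    and long: "\<And>k. (1 - (1 - (1 - q) ^ (length xs div 12)) * (1 - (1 - q) ^ (length xs div 12)))
        ^ ((length xs - k) div 9) \<le> C * s ^ (length xs - k)"
  shows "measure_pmf.prob (Pi_pmf S False (\<lambda>_. bernoulli_pmf q))
      {X. \<exists>k\<in>{a..length xs - a}. \<nexists>ys. vertex_cycle (H \<union> arcs_of n lab X) ys \<and> length ys = k}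
    \<le> 2 * C * (s ^ a / (1 - s))"
proof -
  let ?L = "length xs"
  let ?E = "\<lambda>k. {X. \<nexists>ys. vertex_cycle (H \<union> arcs_of n lab X) ys \<and> length ys = k}"
  let ?T = "{a..?L - a}"
  have each: "measure_pmf.prob (Pi_pmf S False (\<lambda>_. bernoulli_pmf q)) (?E k) \<le> C * s ^ k + C * s ^ (?L - k)"
    if "k \<in> ?T" for k
  proof (cases "k \<le> 4 * (?L div 12)")
    case True
    have "measure_pmf.prob (Pi_pmf S False (\<lambda>_. bernoulli_pmf q)) (?E k) \<le> C * s ^ k"
      using prob_no_short_cycle_le[OF H refl q _ True] short[OF _ True] that a by force
    moreover have "0 \<le> C * s ^ (?L - k)" using s by simp
    ultimately show ?thesis by linarith
  next
    case False
    have "measure_pmf.prob (Pi_pmf S False (\<lambda>_. bernoulli_pmf q)) (?E k) \<le> C * s ^ (?L - k)"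
      using prob_no_long_cycle_le[OF H refl q, of k] long[of k] that a False K by force
    moreover have "0 \<le> C * s ^ k" using s by simp
    ultimately show ?thesis by linarith
  qed
  have "measure_pmf.prob (Pi_pmf S False (\<lambda>_. bernoulli_pmf q)) (\<Union>k\<in>?T. ?E k)
      \<le> (\<Sum>k\<in>?T. measure_pmf.prob (Pi_pmf S False (\<lambda>_. bernoulli_pmf q)) (?E k))"
    by (intro measure_pmf.finite_measure_subadditive_finite) auto
  also have "\<dots> \<le> (\<Sum>k\<in>?T. C * s ^ k + C * s ^ (?L - k))"
    using each by (intro sum_mono) auto
  also have "\<dots> = C * ((\<Sum>k\<in>?T. s ^ k) + (\<Sum>k\<in>?T. s ^ (?L - k)))"
    by (simp add: sum.distrib sum_distrib_left algebra_simps)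
  also have "\<dots> \<le> C * (s ^ a / (1 - s) + s ^ a / (1 - s))"
    using s a by (intro mult_left_mono add_mono sum_powers_le) (auto simp: inj_on_def)
  also have "\<dots> = 2 * C * (s ^ a / (1 - s))" by (simp only: mult_2[symmetric] ac_simps)
  finally have "measure_pmf.prob (Pi_pmf S False (\<lambda>_. bernoulli_pmf q)) (\<Union>k\<in>?T. ?E k)
      \<le> 2 * C * (s ^ a / (1 - s))" .
  moreover have "(\<Union>k\<in>?T. ?E k) =
      {X. \<exists>k\<in>?T. \<nexists>ys. vertex_cycle (H \<union> arcs_of n lab X) ys \<and> length ys = k}" by auto
  ultimately show ?thesis by metis
qed

definition vertex_cycle_lengths :: "nat \<Rightarrow> ('a \<times> 'a) set \<Rightarrow> nat set" where
  "vertex_cycle_lengths l E = {length xs |xs. vertex_cycle E xs \<and> l \<le> length xs}"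

lemma vertex_cycle_arcs_of:
  assumes "vertex_cycle (arcs_of n lab X) xs"
  shows "set xs \<subseteq> {..<n}" "length xs \<le> n"
proof -
  show *: "set xs \<subseteq> {..<n}" using set_vertex_cycle[OF assms] by (auto simp: arcs_of_def)
  have "length xs = card (set xs)" using assms by (simp add: vertex_cycle_def distinct_card)
  also have "\<dots> \<le> n" using card_mono[OF _ *] by simp
  finally show "length xs \<le> n" .
qed

text \<open>
  Positivity excludes the value 0 that stands for the absence of cycles.
\<close>
lemma longest_vertex_cycle:
  assumes "0 < longest (vertex_cycle_lengths l (arcs_of n lab X))"
  obtains xs where "vertex_cycle (arcs_of n lab X) xs"
    "length xs = longest (vertex_cycle_lengths l (arcs_of n lab X))"
proof -
  let ?A = "vertex_cycle_lengths l (arcs_of n lab X)"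
  have "?A \<subseteq> {..n}" using vertex_cycle_arcs_of(2) by (auto simp: vertex_cycle_lengths_def)
  then have "finite ?A" by (rule finite_subset) simp
  then have "longest ?A \<in> insert 0 ?A" unfolding longest_def by (intro Max_in) auto
  with assms that show ?thesis by (auto simp: vertex_cycle_lengths_def)
qed

text \<open>
  The statement for both models at once; the parameter \<open>l\<close> is the least length that counts as a cycle.
  It is harmless because \<open>\<omega>\<close> eventually exceeds it.
\<close>
lemma all_cycle_lengths_whp:
  fixes lab :: "nat \<times> nat \<Rightarrow> 'i" and S :: "nat \<Rightarrow> 'i set" and c c' \<gamma> :: real
    and \<omega> L' :: "nat \<Rightarrow> real" and l :: nat
  assumes lab: "\<And>n. pair_labelling n lab (S n)"
    and "c > c'" "c' > 1" "\<gamma> > 0" and \<omega>: "filterlim \<omega> at_top sequentially"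
    and whp': "whp (\<lambda>n. Pi_pmf (S n) False (\<lambda>_. bernoulli_pmf (c' / real n)))
      (\<lambda>n X. real (longest (vertex_cycle_lengths l (arcs_of n lab X))) \<ge> L' n \<and> L' n \<ge> \<gamma> * real n)"
  shows "whp (\<lambda>n. Pi_pmf (S n) False (\<lambda>_. bernoulli_pmf (c / real n)))
      (\<lambda>n X. {k::int. \<omega> n \<le> real_of_int k \<and> real_of_int k \<le> L' n - \<omega> n}
                \<subseteq> int ` vertex_cycle_lengths l (arcs_of n lab X))"
proof -
  define \<epsilon> where "\<epsilon> = c - c'"
  have \<epsilon>: "0 < \<epsilon>" using assms by (simp add: \<epsilon>_def)
  obtain C s where C: "0 < C" and s: "0 < s" "s < 1"
    and short: "\<forall>n L K k q. 288 \<le> \<gamma> * real n \<longrightarrow> \<gamma> * real n \<le> real L \<longrightarrow> L \<le> n \<longrightarrow> K = L div 12 \<longrightarrow>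
           \<epsilon> / real n \<le> q \<longrightarrow> q \<le> 1 \<longrightarrow> 2 \<le> k \<longrightarrow> k \<le> 4 * K \<longrightarrow>
           (1 - (1 - (1 - q) ^ K) * (1 - (1 - q) ^ ((k - 2) div 2))) ^ K \<le> C * s ^ k"
    and long: "\<forall>n L K k q. 288 \<le> \<gamma> * real n \<longrightarrow> \<gamma> * real n \<le> real L \<longrightarrow> L \<le> n \<longrightarrow> K = L div 12 \<longrightarrow>
           \<epsilon> / real n \<le> q \<longrightarrow> q \<le> 1 \<longrightarrow>
           (1 - (1 - (1 - q) ^ K) * (1 - (1 - q) ^ K)) ^ ((L - k) div 9) \<le> C * s ^ (L - k)"
    by (rule chord_failure_bounds[OF \<epsilon> \<open>\<gamma> > 0\<close>]) (rule that)
  define a where "a n = nat \<lceil>\<omega> n\<rceil>" for n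
  define \<delta> where "\<delta> n = 2 * C * (s ^ a n / (1 - s))" for n
  define M where "M p n = Pi_pmf (S n) False (\<lambda>_. bernoulli_pmf (p / real n))" for p n
  define Good where "Good n X \<longleftrightarrow>
    real (longest (vertex_cycle_lengths l (arcs_of n lab X))) \<ge> L' n \<and> L' n \<ge> \<gamma> * real n" for n X
  define Concl where "Concl n X \<longleftrightarrow> {k::int. \<omega> n \<le> real_of_int k \<and> real_of_int k \<le> L' n - \<omega> n}
                \<subseteq> int ` vertex_cycle_lengths l (arcs_of n lab X)" for n X
  have "filterlim a at_top sequentially"
    unfolding filterlim_at_top
  proof
    fix Z
    have "eventually (\<lambda>n. real Z \<le> \<omega> n) sequentially" using \<omega> by (simp add: filterlim_at_top)
    then show "eventually (\<lambda>n. Z \<le> a n) sequentially"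
      by eventually_elim (unfold a_def, linarith)
  qed
  then have "(\<lambda>n. s ^ a n) \<longlonglongrightarrow> 0"
    using s by (intro filterlim_compose[OF LIMSEQ_power_zero]) auto
  then have "(\<lambda>n. 2 * C * (s ^ a n / (1 - s))) \<longlonglongrightarrow> 2 * C * (0 / (1 - s))"
    by (intro tendsto_intros) (use s in auto)
  then have \<delta>0: "\<delta> \<longlonglongrightarrow> 0" by (simp add: \<delta>_def[abs_def])
  have G1: "(\<lambda>n. measure_pmf.prob (M c' n) {X. Good n X}) \<longlonglongrightarrow> 1"
    using whp' by (simp add: whp_def M_def Good_def)
  \<comment> \<open>Beyond \<open>c\<close>, the quotients \<open>c / n\<close> and \<open>c' / n\<close> are genuine probabilities; beyond \<open>288 / \<gamma>\<close>, the
      bounds on the failure probabilities apply.\<close>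
  have "eventually (\<lambda>n. real n > 288 / \<gamma> + c) sequentially"
    by (rule filterlim_at_top_dense[THEN iffD1, OF filterlim_real_sequentially, rule_format])
  moreover have "eventually (\<lambda>n. \<omega> n \<ge> real (max 2 l)) sequentially"
    using \<omega> by (auto simp: filterlim_at_top)
  ultimately have lower: "eventually (\<lambda>n. measure_pmf.prob (M c' n) {X. Good n X} - \<delta> n
      \<le> measure_pmf.prob (M c n) {X. Concl n X}) sequentially"
  proof eventually_elim
    fix n assume n: "real n > 288 / \<gamma> + c" and w: "\<omega> n \<ge> real (max 2 l)"
    interpret pair_labelling n lab "S n" by (rule lab)
    have "288 / \<gamma> > 0" using assms by simp
    then have nc: "real n > c" "real n > 288 / \<gamma>" "c > 1" "real n > 0" using n assms by linarith+
    then have g288: "288 \<le> \<gamma> * real n" using assms(4) by (simp add: field_simps)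
    define p where "p = c' / real n"
    define r where "r = c / real n"
    \<comment> \<open>The sprinkling probability solves \<open>1 - r = (1 - p) (1 - q)\<close>.\<close>
    define q where "q = (r - p) / (1 - p)"
    have p: "0 \<le> p" "p < 1" "p < r" "r \<le> 1" using nc assms by (auto simp: p_def r_def field_simps)
    have q: "0 \<le> q" "q \<le> 1" "r = p + (1 - p) * q" using p by (auto simp: q_def field_simps)
    have "0 < 1 - p" using p by simp
    moreover have "(r - p) * (1 - p) \<le> r - p" using p by (intro mult_left_le) linarith+
    ultimately have "r - p \<le> q" unfolding q_def by (rule pos_le_divide_eq[THEN iffD2])
    then have qe: "\<epsilon> / real n \<le> q" by (simp add: r_def p_def \<epsilon>_def diff_divide_distrib)
    have a: "a n \<ge> 2" "a n \<ge> l" using w unfolding a_def by linarith+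
    have "measure_pmf.prob (Pi_pmf (S n) False (\<lambda>_. bernoulli_pmf r)) {X. \<not> Concl n X}
       \<le> measure_pmf.prob (Pi_pmf (S n) False (\<lambda>_. bernoulli_pmf p)) {X. \<not> Good n X} + \<delta> n"
    proof (rule prob_sprinkle_le[OF finite_labels p(1) less_imp_le[OF p(2)] q])
      show "0 \<le> \<delta> n" using C s by (simp add: \<delta>_def)
      fix X assume X: "Good n X"
      let ?L = "longest (vertex_cycle_lengths l (arcs_of n lab X))"
      have L: "\<gamma> * real n \<le> real ?L" "L' n \<le> real ?L" using X by (auto simp: Good_def)
      have "0 < ?L" using L g288 by linarith
      then obtain xs where xs: "vertex_cycle (arcs_of n lab X) xs" "length xs = ?L"
        by (rule longest_vertex_cycle)
      note sub = vertex_cycle_arcs_of[OF xs(1)]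
      have "{Y. \<not> Concl n (\<lambda>e. e \<in> S n \<and> (X e \<or> Y e))} \<subseteq>
        {Y. \<exists>k\<in>{a n..length xs - a n}. \<nexists>ys. vertex_cycle (arcs_of n lab X \<union> arcs_of n lab Y) ys \<and> length ys = k}"
      proof clarify
        fix Y assume "\<not> Concl n (\<lambda>e. e \<in> S n \<and> (X e \<or> Y e))"
        moreover have "arcs_of n lab (\<lambda>e. e \<in> S n \<and> (X e \<or> Y e)) = arcs_of n lab X \<union> arcs_of n lab Y"
          using lab_in by (auto simp: arcs_of_def)
        ultimately obtain k :: int where k: "\<omega> n \<le> k" "k \<le> L' n - \<omega> n"
          and no: "k \<notin> int ` vertex_cycle_lengths l (arcs_of n lab X \<union> arcs_of n lab Y)"
          unfolding Concl_def by auto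
        have "real (a n) = \<lceil>\<omega> n\<rceil>" using w by (simp add: a_def)
        then have ka: "int (a n) \<le> k" "k \<le> int ?L - int (a n)"
          using k L(2) by linarith+
        then have "nat k \<in> {a n..length xs - a n}" using xs(2) by auto
        moreover have "\<nexists>ys. vertex_cycle (arcs_of n lab X \<union> arcs_of n lab Y) ys \<and> length ys = nat k"
        proof
          assume "\<exists>ys. vertex_cycle (arcs_of n lab X \<union> arcs_of n lab Y) ys \<and> length ys = nat k"
          then obtain ys where "vertex_cycle (arcs_of n lab X \<union> arcs_of n lab Y) ys" "length ys = nat k"
            by blast
          moreover have "l \<le> nat k" using ka(1) a(2) by linarith
          ultimately have "nat k \<in> vertex_cycle_lengths l (arcs_of n lab X \<union> arcs_of n lab Y)"
            unfolding vertex_cycle_lengths_def by (intro CollectI exI[of _ ys]) simp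
          then have "int (nat k) \<in> int ` vertex_cycle_lengths l (arcs_of n lab X \<union> arcs_of n lab Y)"
            by (rule imageI)
          moreover have "int (nat k) = k" using ka(1) by linarith
          ultimately show False using no by metis
        qed
        ultimately show "\<exists>k\<in>{a n..length xs - a n}. \<nexists>ys. vertex_cycle (arcs_of n lab X \<union> arcs_of n lab Y) ys \<and> length ys = k"
          by (rule bexI[rotated])
      qed
      then have "measure_pmf.prob (Pi_pmf (S n) False (\<lambda>_. bernoulli_pmf q))
            {Y. \<not> Concl n (\<lambda>e. e \<in> S n \<and> (X e \<or> Y e))}
          \<le> measure_pmf.prob (Pi_pmf (S n) False (\<lambda>_. bernoulli_pmf q))
            {Y. \<exists>k\<in>{a n..length xs - a n}. \<nexists>ys. vertex_cycle (arcs_of n lab X \<union> arcs_of n lab Y) ys \<and> length ys = k}"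
        by (rule measure_pmf.finite_measure_mono) simp
      also have "\<dots> \<le> \<delta> n"
        unfolding \<delta>_def
      proof (rule prob_missing_cycle_length_le[OF xs(1) sub(1) q(1,2) _ a(1) s C])
        show "12 \<le> length xs div 12" using L(1) g288 xs(2) by linarith
        show "(1 - (1 - (1 - q) ^ (length xs div 12)) * (1 - (1 - q) ^ ((k - 2) div 2))) ^ (length xs div 12) \<le> C * s ^ k"
          if "2 \<le> k" "k \<le> 4 * (length xs div 12)" for k
          using short[rule_format, OF g288 _ sub(2) refl qe q(2) that] L(1) xs(2) by simp
        show "(1 - (1 - (1 - q) ^ (length xs div 12)) * (1 - (1 - q) ^ (length xs div 12)))
            ^ ((length xs - k) div 9) \<le> C * s ^ (length xs - k)" for k
          using long[rule_format, OF g288 _ sub(2) refl qe q(2)] L(1) xs(2) by simp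
      qed
      finally show "measure_pmf.prob (Pi_pmf (S n) False (\<lambda>_. bernoulli_pmf q))
            {Y. \<not> Concl n (\<lambda>e. e \<in> S n \<and> (X e \<or> Y e))} \<le> \<delta> n" .
    qed
    moreover have "measure_pmf.prob N {X. \<not> P X} = 1 - measure_pmf.prob N {X. P X}" for N :: "('i \<Rightarrow> bool) pmf" and P
      by (subst measure_pmf.prob_compl[symmetric]) (auto intro!: arg_cong[where f = "measure_pmf.prob N"])
    ultimately show "measure_pmf.prob (M c' n) {X. Good n X} - \<delta> n \<le> measure_pmf.prob (M c n) {X. Concl n X}"
      by (simp add: M_def p_def r_def)
  qed
  have "(\<lambda>n. measure_pmf.prob (M c' n) {X. Good n X} - \<delta> n) \<longlonglongrightarrow> 1"
    using tendsto_diff[OF G1 \<delta>0] by simp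
  then have "(\<lambda>n. measure_pmf.prob (M c n) {X. Concl n X}) \<longlonglongrightarrow> 1"
    by (intro tendsto_sandwich[OF lower _ _ tendsto_const]) auto
  then show ?thesis by (simp add: whp_def M_def Concl_def)
qed

lemma arcs_of_subset: "arcs_of n lab X \<subseteq> {..<n} \<times> {..<n}"
  by (auto simp: arcs_of_def)

lemma whp_map_pmf: "whp (\<lambda>n. map_pmf (f n) (M n)) E \<longleftrightarrow> whp M (\<lambda>n x. E n (f n x))"
  by (simp add: whp_def vimage_def)

theorem corollary3p4:
  fixes c c' \<gamma> :: real and \<omega> L' :: "nat \<Rightarrow> real"
  assumes "c > c'" and "c' > 1" and "\<gamma> > 0"
    and "filterlim \<omega> at_top sequentially"
  shows
    "(whp (\<lambda>n. binomial_graph n (c' / real n))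
        (\<lambda>n G'. real (longest (cycle_lengths G')) \<ge> L' n \<and> L' n \<ge> \<gamma> * real n) \<longrightarrow>
      whp (\<lambda>n. binomial_graph n (c / real n))
        (\<lambda>n G. {k::int. \<omega> n \<le> real_of_int k \<and> real_of_int k \<le> L' n - \<omega> n}
                \<subseteq> int ` cycle_lengths G)) \<and>
     (whp (\<lambda>n. binomial_digraph n (c' / real n))
        (\<lambda>n G'. real (longest (dicycle_lengths G')) \<ge> L' n \<and> L' n \<ge> \<gamma> * real n) \<longrightarrow>
      whp (\<lambda>n. binomial_digraph n (c / real n))
        (\<lambda>n G. {k::int. \<omega> n \<le> real_of_int k \<and> real_of_int k \<le> L' n - \<omega> n}
                \<subseteq> int ` dicycle_lengths G))"
proof -
  define edge where "edge = (\<lambda>(u, v). {u, v} :: nat set)"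
  have "finite (unordered_pairs n)" for n
    by (rule finite_subset[of _ "Pow {..<n}"]) (auto simp: unordered_pairs_def)
  then have U: "pair_labelling n edge (unordered_pairs n)" for n
    by unfold_locales (auto simp: edge_def unordered_pairs_def)
  have "finite (ordered_pairs n)" for n
    by (rule finite_subset[of _ "{..<n} \<times> {..<n}"]) (auto simp: ordered_pairs_def)
  then have O: "pair_labelling n id (ordered_pairs n)" for n
    by unfold_locales (auto simp: ordered_pairs_def)
  have graph: "binomial_graph n p =
      map_pmf (\<lambda>X. \<lparr>pverts = {..<n}, parcs = arcs_of n edge X\<rparr>)
        (Pi_pmf (unordered_pairs n) False (\<lambda>_. bernoulli_pmf p))" for n p
    unfolding binomial_graph_def
    by (intro arg_cong[where f = "\<lambda>f. map_pmf f _"] ext)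
      (auto simp: arcs_of_def edge_def unordered_pairs_def card_insert_if)
  have digraph: "binomial_digraph n p =
      map_pmf (\<lambda>X. \<lparr>pverts = {..<n}, parcs = arcs_of n id X\<rparr>)
        (Pi_pmf (ordered_pairs n) False (\<lambda>_. bernoulli_pmf p))" for n p
    unfolding binomial_digraph_def
    by (intro arg_cong[where f = "\<lambda>f. map_pmf f _"] ext) (auto simp: arcs_of_def ordered_pairs_def)
  have cl: "cycle_lengths \<lparr>pverts = {..<n}, parcs = arcs_of n edge X\<rparr> =
      vertex_cycle_lengths 3 (arcs_of n edge X)" for n X
    using cycle_lengths_vertex_cycle[of "\<lparr>pverts = {..<n}, parcs = arcs_of n edge X\<rparr>" 3] arcs_of_subset[of n edge X]
    by (simp add: cycle_lengths_def vertex_cycle_lengths_def)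
  have dl: "dicycle_lengths \<lparr>pverts = {..<n}, parcs = arcs_of n id X\<rparr> =
      vertex_cycle_lengths 0 (arcs_of n id X)" for n X
    using cycle_lengths_vertex_cycle[of "\<lparr>pverts = {..<n}, parcs = arcs_of n id X\<rparr>" 0] arcs_of_subset[of n id X]
    by (simp add: dicycle_lengths_def vertex_cycle_lengths_def)
  show ?thesis
    unfolding graph digraph whp_map_pmf cl dl
    by (intro conjI impI all_cycle_lengths_whp[OF U assms] all_cycle_lengths_whp[OF O assms])
qed

end
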